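(* Let $d,k\in\mathbb{N}$ (positive integers). There exists a finite acyclic digraph $D=(V,A)$ with the following properties. (i) $D$ has maximum indegree $d$. (ii) For every vertex $v$, the set $\{v\}\cup N^-(v)$, where $N^-(v)=\{u\in V: uv\in A\}$ is the in-neighborhood of $v$, induces a transitive tournament in $D$. (iii) $D$ admits a homomorphism to the acyclic (transitive) tournament on $2^k+1$ vertices. (iv) If $D$ is covered by $k$ cuts, then for any $k$-cut cover of $D$ there is some vertex $v$ of indegree $d$ such that the characteristic sets of the $d+1$ vertices in $\{v\}\cup N^-(v)$ are pairwise incomparable (with respect to inclusion). In particular, if $d\geq \binom{k}{\lfloor k/2\rfloor}$, then $D$ is not covered by $k$ cuts.
   Context: A cut in a digraph $D=(V,A)$ is a set of arcs $\{uv\in A: u\in U, v\notin U\}$ for some $U\subseteq V$. $D$ is covered by $k$ cuts (has a $k$-cut cover) if there are $U_1,\dots,U_k\subseteq V$ such that every arc $uv\in A$ has some $a\in\{1,\dots,k\}$ with $u\in U_a$, $v\notin U_a$. The characteristic set of a vertex $v$ with respect to such a cover is $C(v)=\{a\in\{1,\dots,k\}: v\in U_a\}$; equivalently, a $k$-cut cover is a labeling $C:V\to\mathcal{P}(\{1,\dots,k\})$ with $C(u)\not\subseteq C(v)$ for every arc $uv\in A$. A homomorphism from $D$ to a digraph $H$ is a map $l$ from $V$ to the vertices of $H$ such that $l(u)l(v)$ is an arc of $H$ for every arc $uv\in A$.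
   Formalization: In (i), maximum indegree exactly d is claimed only for d ≤ 2^k; for d > 2^k only that all indegrees are at most d, since (ii) and (iii) make a vertex of indegree d > 2^k impossible (d+1 tournament vertices would map injectively into 2^k+1). *)

theory Defs
  imports "Graph_Theory.Graph_Theory"
begin

definition in_neighborhood :: "'a pair_pre_digraph \<Rightarrow> 'a \<Rightarrow> 'a set" where
  "in_neighborhood D v = {u. (u, v) \<in> parcs D}"

definition transitive_tournament :: "('a, 'b) pre_digraph \<Rightarrow> bool" where
  "transitive_tournament T \<longleftrightarrow>
     digraph T \<and>
     (\<forall>u\<in>verts T. \<forall>v\<in>verts T. u \<noteq> v \<longrightarrow>
        (u \<rightarrow>\<^bsub>T\<^esub> v \<or> v \<rightarrow>\<^bsub>T\<^esub> u) \<and> \<not> (u \<rightarrow>\<^bsub>T\<^esub> v \<and> v \<rightarrow>\<^bsub>T\<^esub> u)) \<and>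
     trans (arcs_ends T)"

text \<open>The acyclic tournament on \<open>n\<close> vertices is unique up to isomorphism; this is the
  representative on \<open>0, \<dots>, n - 1\<close>.\<close>
definition acyclic_tournament :: "nat \<Rightarrow> nat pair_pre_digraph" where
  "acyclic_tournament n = \<lparr> pverts = {..<n}, parcs = {(i, j). i < j \<and> j < n} \<rparr>"

definition digraph_hom :: "('a \<Rightarrow> 'b) \<Rightarrow> 'a pair_pre_digraph \<Rightarrow> 'b pair_pre_digraph \<Rightarrow> bool" where
  "digraph_hom l D H \<longleftrightarrow>
     (\<forall>v\<in>pverts D. l v \<in> pverts H) \<and> (\<forall>(u, v)\<in>parcs D. (l u, l v) \<in> parcs H)"

definition cut :: "'a pair_pre_digraph \<Rightarrow> 'a set \<Rightarrow> ('a \<times> 'a) set" where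
  "cut D U = {(u, v) \<in> parcs D. u \<in> U \<and> v \<notin> U}"

text \<open>A cover is the indexed family of the vertex sets \<open>U\<^sub>1, \<dots>, U\<^sub>k\<close>; values of \<open>U\<close> outside
  \<open>{1..k}\<close> play no role.\<close>
definition cut_cover :: "'a pair_pre_digraph \<Rightarrow> nat \<Rightarrow> (nat \<Rightarrow> 'a set) \<Rightarrow> bool" where
  "cut_cover D k U \<longleftrightarrow>
     (\<forall>a\<in>{1..k}. U a \<subseteq> pverts D) \<and> parcs D \<subseteq> (\<Union>a\<in>{1..k}. cut D (U a))"

definition covered_by_cuts :: "'a pair_pre_digraph \<Rightarrow> nat \<Rightarrow> bool" where
  "covered_by_cuts D k \<longleftrightarrow> (\<exists>U. cut_cover D k U)"

definition char_set :: "nat \<Rightarrow> (nat \<Rightarrow> 'a set) \<Rightarrow> 'a \<Rightarrow> nat set" where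
  "char_set k U v = {a \<in> {1..k}. v \<in> U a}"

lemma transitive_tournament_acyclic_tournament:
  "transitive_tournament (with_proj (acyclic_tournament n))"
proof -
  have "parcs (acyclic_tournament n) \<subseteq> {..<n} \<times> {..<n}"
    by (auto simp: acyclic_tournament_def)
  then have "finite (parcs (acyclic_tournament n))"
    by (rule finite_subset) simp
  then have "pair_digraph (acyclic_tournament n)"
    by unfold_locales (auto simp: acyclic_tournament_def)
  then interpret pair_digraph "acyclic_tournament n" .
  have "digraph (with_proj (acyclic_tournament n))"
    by unfold_locales
  then show ?thesis
    unfolding transitive_tournament_def
    by (auto simp: acyclic_tournament_def trans_def)
qed

text \<open>A digraph in which every vertex together with its in-neighborhood induces a transitive
  tournament and which maps to the acyclic tournament on \<open>n\<close> vertices has all indegrees below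
  \<open>n\<close>, because a homomorphism to a loopless digraph is injective on tournaments. For \<open>n = 2 ^ k + 1\<close> an indegree \<open>d\<close> is thus possible only if
  \<open>d \<le> 2 ^ k\<close>; for larger \<open>d\<close>, ``maximum indegree \<open>d\<close>'' can only mean that \<open>d\<close> is an upper bound.\<close>
lemma in_degree_less_if_hom_acyclic_tournament:
  assumes D: "pair_digraph D" and v: "v \<in> pverts D"
    and tt: "transitive_tournament (D \<restriction> insert v (in_neighborhood D v))"
    and hom: "digraph_hom l D (acyclic_tournament n)"
  shows "in_degree D v < n"
proof -
  interpret pair_digraph D by (rule D)
  let ?N = "in_neighborhood D v"
  have N: "?N \<subseteq> pverts D" by (auto simp: in_neighborhood_def dest: in_arcsD1)
  then have fin: "finite ?N" using pair_finite_verts finite_subset by blast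
  have vN: "v \<notin> ?N" by (auto simp: in_neighborhood_def dest: no_loops')
  have "in_arcs D v = (\<lambda>u. (u, v)) ` ?N"
    by (auto simp: in_neighborhood_def in_arcs_def)
  then have deg: "in_degree D v = card ?N"
    by (simp add: in_degree_def card_image inj_on_def)
  have ne: "l x \<noteq> l y" if "x \<in> insert v ?N" "y \<in> insert v ?N" "x \<noteq> y" for x y
  proof -
    have "(x, y) \<in> parcs D \<or> (y, x) \<in> parcs D"
      using tt that unfolding transitive_tournament_def
      by (fastforce dest!: dominates_induce_subgraphD)
    then show ?thesis
      using hom by (fastforce simp: digraph_hom_def acyclic_tournament_def)
  qed
  then have "inj_on l (insert v ?N)" by (meson inj_onI)
  moreover have "l ` insert v ?N \<subseteq> {..<n}"
    using hom v N by (auto simp: digraph_hom_def acyclic_tournament_def)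
  ultimately have "card (insert v ?N) \<le> card {..<n}"
    by (intro card_inj_on_le) auto
  then show ?thesis using fin vN deg by simp
qed

end

theory Submission
  imports Defs "HOL-Library.Nat_Bijection" Complex_Main
begin

text \<open>The vertices of \<open>D\<close> are the hereditarily finite sets of rank at most \<open>2 ^ k\<close> which, together
  with all their hereditary elements, are cliques of size at most \<open>d\<close> for the relation \<open>\<in>\<close> (coded as
  natural numbers); the arcs are the pairs
  \<open>u \<in> v\<close>. Given a cover, start from the empty clique \<open>Q\<close> and repeatedly consider the vertex
  \<open>v = Q\<close>, whose in-neighborhood is \<open>Q\<close>. If \<open>Q\<close> is an antichain with respect to \<open>C\<close>, then removing
  from \<open>Q\<close> all \<open>u\<close> with \<open>C(v) \<subseteq> C(u)\<close> and adding \<open>v\<close> gives a clique that is again an antichain.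
  As \<open>C(v)\<close> contains no \<open>C(u)\<close> with \<open>u \<in> Q\<close>, the up-set generated by \<open>C(Q)\<close> grows strictly with
  each step, so within \<open>2 ^ k + 1\<close> steps the new antichain must exceed the size \<open>d\<close>, and then \<open>v\<close> is
  the required vertex. The last claim is Sperner's theorem.\<close>

section \<open>Antichains: the LYM inequality and Sperner's theorem\<close>

definition incomparable_on :: "('a \<Rightarrow> 'p::order) \<Rightarrow> 'a set \<Rightarrow> bool" where
  "incomparable_on C Q \<longleftrightarrow> pairwise (\<lambda>x y. \<not> C x \<le> C y \<and> \<not> C y \<le> C x) Q"

text \<open>Averaging over points: the members of \<open>A\<close> avoiding \<open>x\<close> form an
  antichain in \<open>X - {x}\<close>, and summing the inequality for these over all
  \<open>x\<close> gives \<open>card X\<close> times the claim. An antichain containing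
  \<open>X\<close> itself is just \<open>{X}\<close>.\<close>

lemma LYM_inequality:
  assumes "finite X" "A \<subseteq> Pow X" "incomparable_on (\<lambda>S. S) A"
  shows "(\<Sum>S\<in>A. 1 / real (card X choose card S)) \<le> 1"
  using assms
proof (induction "card X" arbitrary: X A)
  case 0
  then have "A = {} \<or> A = {{}}" by auto
  then show ?case by auto
next
  case (Suc n)
  have finA: "finite A" using Suc.prems by (meson finite_Pow_iff finite_subset)
  show ?case
  proof (cases "X \<in> A")
    case True
    have "S = X" if "S \<in> A" for S
      using Suc.prems True that unfolding incomparable_on_def pairwise_def by blast
    then have "A = {X}" using True by blast
    then show ?thesis by simp
  next
    case False
    \<comment> \<open>Strictness keeps \<open>n choose card S\<close> positive, so that no weight in
      the induction hypothesis is a division by zero.\<close>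
    have card_less: "card S < card X" if "S \<in> A" for S
      using that False Suc.prems by (metis PowD psubsetI psubset_card_mono subsetD)
    let ?c = "\<lambda>m S. 1 / real (m choose card S)"
    have IH: "(\<Sum>S\<in>{S\<in>A. x \<notin> S}. ?c n S) \<le> 1" if "x \<in> X" for x
    proof -
      have n: "card (X - {x}) = n" using that Suc by simp
      have "(\<Sum>S\<in>{S\<in>A. x \<notin> S}. ?c (card (X - {x})) S) \<le> 1"
        by (rule Suc.hyps(1))
          (use n Suc.prems in \<open>auto simp: incomparable_on_def pairwise_def\<close>)
      then show ?thesis by (simp add: n)
    qed
    \<comment> \<open>\<open>S\<close> is avoided by \<open>card (X - S)\<close> points
      \<open>x\<close>; the absorption identity converts the resulting total weight to the
      denominator for \<open>Suc n\<close>.\<close>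
    have absorb: "real (card (X - S)) * ?c n S = real (Suc n) * ?c (Suc n) S" if "S \<in> A" for S
    proof -
      have S: "S \<subseteq> X" "card S \<le> n" using that Suc card_less[OF that] by auto
      have "(Suc n - card S) * (Suc n choose card S) = Suc n * (n choose card S)"
        using binomial_absorb_comp[of "Suc n" "card S"] by simp
      then have "real (Suc n - card S) * real (Suc n choose card S)
          = real (Suc n) * real (n choose card S)"
        by (metis of_nat_mult)
      moreover have "card (X - S) = Suc n - card S"
        using S Suc by (metis card_Diff_subset finite_subset)
      moreover have "n choose card S > 0" "Suc n choose card S > 0"
        using S by (simp_all add: zero_less_binomial)
      ultimately show ?thesis by (simp add: field_simps del: binomial_Suc_Suc)
    qed
    have "real (Suc n) * (\<Sum>S\<in>A. ?c (Suc n) S) = (\<Sum>S\<in>A. \<Sum>x\<in>X - S. ?c n S)"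
      unfolding sum_distrib_left by (rule sum.cong) (simp_all only: absorb sum_constant refl)
    also have "\<dots> = (\<Sum>S\<in>A. \<Sum>x\<in>{x\<in>X. x \<notin> S}. ?c n S)"
      by (simp add: set_diff_eq)
    \<comment> \<open>Double counting of the pairs with \<open>x \<notin> S\<close>.\<close>
    also have "\<dots> = (\<Sum>x\<in>X. \<Sum>S\<in>{S\<in>A. x \<notin> S}. ?c n S)"
      by (rule sum.swap_restrict[OF finA \<open>finite X\<close>])
    also have "\<dots> \<le> (\<Sum>x\<in>X. 1)"
      by (rule sum_mono) (rule IH)
    also have "\<dots> = real (Suc n)" using Suc by simp
    finally have "real (Suc n) * (\<Sum>S\<in>A. ?c (Suc n) S) \<le> real (Suc n) * 1" by simp
    then show ?thesis
      using Suc.hyps(2) by (metis mult_le_cancel_left_pos of_nat_0_less_iff zero_less_Suc)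
  qed
qed

text \<open>The central binomial coefficient is the largest, so each term of the LYM sum is at least
  its reciprocal.\<close>

lemma sperner:
  assumes "finite X" "A \<subseteq> Pow X" "incomparable_on (\<lambda>S. S) A"
  shows "card A \<le> card X choose (card X div 2)"
proof -
  let ?M = "card X choose (card X div 2)"
  have M: "?M > 0" by (simp add: zero_less_binomial)
  have "real (card A) / real ?M = (\<Sum>S\<in>A. 1 / real ?M)" by simp
  also have "\<dots> \<le> (\<Sum>S\<in>A. 1 / real (card X choose card S))"
  proof (rule sum_mono)
    fix S assume "S \<in> A"
    then have "card X choose card S > 0"
      using assms by (auto simp: card_mono zero_less_binomial)
    then show "1 / real ?M \<le> 1 / real (card X choose card S)"
      by (simp add: frac_le binomial_maximum)
  qed
  also have "\<dots> \<le> 1" by (rule LYM_inequality[OF assms])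
  finally show ?thesis using M by simp
qed

section \<open>Binary codes of hereditary membership cliques\<close>

lemma mem_set_decode_less: "u \<in> set_decode v \<Longrightarrow> u < v"
  \<comment> \<open>If \<open>v \<le> u\<close> then \<open>v < 2 ^ u\<close>, so bit
    \<open>u\<close> of \<open>v\<close> is 0.\<close>
  by (rule ccontr) (use less_exp[of u] in \<open>auto simp: set_decode_def\<close>)

definition membership_clique :: "nat set \<Rightarrow> bool" where
  "membership_clique Q \<longleftrightarrow> pairwise (\<lambda>x y. x \<in> set_decode y \<or> y \<in> set_decode x) Q"

text \<open>Level \<open>n\<close> holds sets of rank below \<open>n\<close>: level 0 is empty, and
  level 1 contains only 0, the code of the empty set. The clique condition is hereditary because
  elements come from the previous level.\<close>

fun clique_codes :: "nat \<Rightarrow> nat \<Rightarrow> nat set" where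
  "clique_codes d 0 = {}"
| "clique_codes d (Suc n) =
    set_encode ` {Q. Q \<subseteq> clique_codes d n \<and> card Q \<le> d \<and> membership_clique Q}"

lemma finite_clique_codes: "finite (clique_codes d n)"
  by (induction n) auto

lemma mem_clique_codes_Suc:
  "v \<in> clique_codes d (Suc n) \<longleftrightarrow>
     set_decode v \<subseteq> clique_codes d n \<and> card (set_decode v) \<le> d \<and> membership_clique (set_decode v)"
proof
  assume "v \<in> clique_codes d (Suc n)"
  then obtain Q where "v = set_encode Q" "Q \<subseteq> clique_codes d n" "card Q \<le> d" "membership_clique Q"
    by auto
  \<comment> \<open>Decoding recovers \<open>Q\<close> from its code only because levels are
    finite.\<close>
  moreover from this have "finite Q" using finite_clique_codes finite_subset by blast
  ultimately show "set_decode v \<subseteq> clique_codes d n \<and> card (set_decode v) \<le> d \<and>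
      membership_clique (set_decode v)" by simp
next
  assume "set_decode v \<subseteq> clique_codes d n \<and> card (set_decode v) \<le> d \<and>
      membership_clique (set_decode v)"
  then show "v \<in> clique_codes d (Suc n)"
    by (auto intro!: image_eqI[where x = "set_decode v"])
qed

declare clique_codes.simps(2) [simp del]

lemma clique_codes_Suc_mono: "clique_codes d n \<subseteq> clique_codes d (Suc n)"
proof (induction n)
  case (Suc n)
  then show ?case
    using mem_clique_codes_Suc[of _ d n] mem_clique_codes_Suc[of _ d "Suc n"] by blast
qed simp

lemma clique_codes_mono: "m \<le> n \<Longrightarrow> clique_codes d m \<subseteq> clique_codes d n"
  by (rule lift_Suc_mono_le[of "clique_codes d"]) (rule clique_codes_Suc_mono)

lemma mem_clique_codesD:
  assumes "v \<in> clique_codes d n"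
  shows "set_decode v \<subseteq> clique_codes d n" "card (set_decode v) \<le> d"
    "membership_clique (set_decode v)"
  using assms clique_codes_Suc_mono[of d "n - 1"]
  by (cases n; force simp: mem_clique_codes_Suc)+

section \<open>The membership digraph: local tournaments and rank\<close>

definition clique_code_graph :: "nat \<Rightarrow> nat \<Rightarrow> nat pair_pre_digraph" where
  "clique_code_graph d n =
     \<lparr> pverts = clique_codes d n, parcs = {(u, v). v \<in> clique_codes d n \<and> u \<in> set_decode v} \<rparr>"

lemma pverts_clique_code_graph [simp]: "pverts (clique_code_graph d n) = clique_codes d n"
  by (simp add: clique_code_graph_def)

lemma parcs_clique_code_graph [simp]:
  "(u, v) \<in> parcs (clique_code_graph d n) \<longleftrightarrow> v \<in> clique_codes d n \<and> u \<in> set_decode v"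
  by (simp add: clique_code_graph_def)

lemma pair_digraph_clique_code_graph: "pair_digraph (clique_code_graph d n)"
proof -
  have "parcs (clique_code_graph d n) \<subseteq> clique_codes d n \<times> clique_codes d n"
    using mem_clique_codesD(1) by (auto simp: clique_code_graph_def)
  moreover from this have "finite (parcs (clique_code_graph d n))"
    by (rule finite_subset) (simp add: finite_clique_codes)
  ultimately show ?thesis
    by unfold_locales (auto simp: finite_clique_codes dest: mem_set_decode_less)
qed

lemma in_neighborhood_clique_code_graph:
  "v \<in> clique_codes d n \<Longrightarrow> in_neighborhood (clique_code_graph d n) v = set_decode v"
  by (simp add: in_neighborhood_def)

lemma in_degree_clique_code_graph:
  assumes "v \<in> clique_codes d n"
  shows "in_degree (clique_code_graph d n) v = card (set_decode v)"
proof -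
  have "in_arcs (clique_code_graph d n) v = (\<lambda>u. (u, v)) ` set_decode v"
    using assms by (auto simp: in_arcs_def)
  then show ?thesis by (simp add: in_degree_def card_image inj_on_def)
qed

lemma acyclic_clique_code_graph: "acyclic (parcs (clique_code_graph d n))"
proof -
  have "parcs (clique_code_graph d n) \<subseteq> {(u, v). u < v}"
    by (auto dest: mem_set_decode_less)
  then show ?thesis
    by (meson acyclic_subset wf_acyclic wf)
qed

text \<open>Membership implies \<open><\<close> on codes, so within a clique the arcs are exactly
  the pairs \<open>x < y\<close>, a linear order. Adding \<open>v\<close> to
  \<open>set_decode v\<close> keeps it a clique.\<close>

lemma transitive_tournament_clique_code_graph:
  assumes v: "v \<in> clique_codes d n"
  defines "D \<equiv> clique_code_graph d n"
  shows "transitive_tournament (D \<restriction> insert v (in_neighborhood D v))"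
proof -
  interpret pair_digraph D unfolding D_def by (rule pair_digraph_clique_code_graph)
  let ?W = "insert v (set_decode v)"
  have N: "in_neighborhood D v = set_decode v"
    unfolding D_def by (rule in_neighborhood_clique_code_graph[OF v])
  have W: "?W \<subseteq> clique_codes d n" using mem_clique_codesD(1)[OF v] v by simp
  have "membership_clique ?W"
    using mem_clique_codesD(3)[OF v] by (auto simp: membership_clique_def pairwise_insert)
  then have clique: "x \<in> set_decode y \<or> y \<in> set_decode x" if "x \<in> ?W" "y \<in> ?W" "x \<noteq> y" for x y
    using that unfolding membership_clique_def by (rule pairwiseD)
  have "digraph (D \<restriction> ?W)"
    by (rule digraphI_induced, rule induced_induce) (use W in \<open>simp add: D_def\<close>)
  moreover have dom: "x \<rightarrow>\<^bsub>with_proj D \<restriction> ?W\<^esub> y \<longleftrightarrow> x \<in> ?W \<and> y \<in> ?W \<and> x \<in> set_decode y" for x y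
    using W by (auto simp: arcs_ends_conv D_def image_def)
  moreover have "trans (arcs_ends (with_proj D \<restriction> ?W))"
  proof (rule transI)
    fix x y z
    assume "x \<rightarrow>\<^bsub>with_proj D \<restriction> ?W\<^esub> y" "y \<rightarrow>\<^bsub>with_proj D \<restriction> ?W\<^esub> z"
    then have *: "x \<in> ?W" "z \<in> ?W" "x < z"
      unfolding dom by (auto dest!: mem_set_decode_less)
    then have "x \<in> set_decode z \<or> z \<in> set_decode x"
      by (intro clique) simp_all
    then show "x \<rightarrow>\<^bsub>with_proj D \<restriction> ?W\<^esub> z"
      unfolding dom using * by (auto dest: mem_set_decode_less)
  qed
  moreover have "\<not> (x \<in> set_decode y \<and> y \<in> set_decode x)" for x y
    by (auto dest!: mem_set_decode_less)
  ultimately show ?thesis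
    unfolding transitive_tournament_def N induce_subgraph_verts dom
    using clique by (intro conjI ballI impI) blast+
qed

text \<open>The homomorphism is the rank, which strictly increases from an element to the set
  containing it.\<close>

lemma digraph_hom_clique_code_graph:
  "\<exists>l. digraph_hom l (clique_code_graph d n) (acyclic_tournament n)"
proof
  \<comment> \<open>The \<open>Suc\<close> makes ranks start at 0, so that those in level
    \<open>n\<close> are below \<open>n\<close>.\<close>
  let ?l = "\<lambda>v. LEAST m. v \<in> clique_codes d (Suc m)"
  have l: "?l v < n" "v \<in> clique_codes d (Suc (?l v))" if v: "v \<in> clique_codes d n" for v
  proof -
    obtain m where m: "n = Suc m" using v by (cases n) auto
    show "v \<in> clique_codes d (Suc (?l v))" by (rule LeastI[of _ m]) (use v m in simp)
    have "?l v \<le> m" by (rule Least_le) (use v m in simp)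
    then show "?l v < n" using m by simp
  qed
  have "?l u < ?l v" if "v \<in> clique_codes d n" "u \<in> set_decode v" for u v
  proof -
    have u: "u \<in> clique_codes d (?l v)"
      using l(2)[OF that(1)] that(2) mem_clique_codes_Suc by blast
    then obtain m where m: "?l v = Suc m" by (cases "?l v") auto
    have "?l u \<le> m" by (rule Least_le) (use u m in simp)
    then show ?thesis using m by simp
  qed
  then show "digraph_hom ?l (clique_code_graph d n) (acyclic_tournament n)"
    using l(1) by (auto simp: digraph_hom_def acyclic_tournament_def)
qed

section \<open>Growing antichains in the membership digraph\<close>

lemma clique_code_graph_incomparable:
  fixes C :: "nat \<Rightarrow> 'p::order"
  assumes S: "finite S" "card S < n" "C ` clique_codes d n \<subseteq> S"
    and C: "\<And>u v. v \<in> clique_codes d n \<Longrightarrow> u \<in> set_decode v \<Longrightarrow> \<not> C u \<le> C v"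
  shows "\<exists>v\<in>clique_codes d n. card (set_decode v) = d \<and> incomparable_on C (insert v (set_decode v))"
proof (rule ccontr)
  assume none: "\<not> ?thesis"
  define up where "up Q = {s\<in>S. \<exists>u\<in>Q. C u \<le> s}" for Q
  have fin_up: "finite (up Q)" for Q using S by (simp add: up_def)
  \<comment> \<open>One level per step: \<open>Q\<close> lies in level \<open>m\<close>, so its code
    lies in level \<open>Suc m\<close>, and \<open>n\<close> levels leave room for \<open>n\<close>
    steps. At \<open>m = n\<close> the up-set would be larger than \<open>S\<close>.\<close>
  have "\<exists>Q. Q \<subseteq> clique_codes d m \<and> card Q \<le> d \<and> membership_clique Q \<and> incomparable_on C Q \<and>
      card (up Q) \<ge> m" if "m \<le> n" for m
    using that
  proof (induction m)
    case 0
    show ?case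
      by (rule exI[of _ "{}"]) (simp add: membership_clique_def incomparable_on_def)
  next
    case (Suc m)
    then obtain Q where Q: "Q \<subseteq> clique_codes d m" "card Q \<le> d" "membership_clique Q"
        "incomparable_on C Q" "card (up Q) \<ge> m"
      by auto
    have finQ: "finite Q" using Q finite_clique_codes finite_subset by blast
    define v where "v = set_encode Q"
    have dec: "set_decode v = Q" using finQ by (simp add: v_def)
    have v: "v \<in> clique_codes d (Suc m)" unfolding mem_clique_codes_Suc dec using Q by blast
    then have vn: "v \<in> clique_codes d n" using clique_codes_mono Suc.prems by blast
    have notle: "\<not> C u \<le> C v" if "u \<in> Q" for u using C[OF vn] that dec by blast
    define R where "R = {u\<in>Q. \<not> C v \<le> C u}"
    have RQ: "R \<subseteq> Q" by (auto simp: R_def)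
    have vQ: "v \<notin> Q" using mem_set_decode_less[of v v] dec by auto
    have inc: "incomparable_on C (insert v R)"
      using Q(4) notle by (auto simp: incomparable_on_def pairwise_def R_def)
    \<comment> \<open>Only \<open>R = Q\<close> with \<open>card Q = d\<close> could break the
      bound, and then \<open>v\<close> would be a vertex of the kind excluded by
      \<open>none\<close>.\<close>
    have "card (insert v R) \<le> d"
    proof (cases "R = Q")
      case True
      then have "card Q \<noteq> d" using none vn inc dec by auto
      then show ?thesis using True Q(2) finQ vQ by simp
    next
      case False
      then have "card R < card Q" using RQ finQ by (simp add: psubset_card_mono psubsetI)
      then show ?thesis using Q(2) finQ RQ vQ by (simp add: finite_subset card_insert_if)
    qed
    moreover have "insert v R \<subseteq> clique_codes d (Suc m)"
      using v Q(1) RQ clique_codes_Suc_mono by blast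
    moreover have "membership_clique (insert v R)"
      using Q(3) RQ dec by (auto simp: membership_clique_def pairwise_def)
    moreover have "card (up (insert v R)) \<ge> Suc m"
    proof -
      \<comment> \<open>A dropped \<open>u\<close> satisfies \<open>C v \<le> C u\<close>, so
        everything above \<open>C u\<close> stays above \<open>C v\<close>.\<close>
      have "up Q \<subseteq> up (insert v R)"
      proof
        fix s assume "s \<in> up Q"
        then obtain u where u: "s \<in> S" "u \<in> Q" "C u \<le> s" by (auto simp: up_def)
        show "s \<in> up (insert v R)"
        proof (cases "u \<in> R")
          case False
          then have "C v \<le> s" using u by (auto simp: R_def intro: order_trans)
          then show ?thesis using u by (auto simp: up_def)
        qed (use u in \<open>auto simp: up_def\<close>)
      qed
      moreover have "C v \<in> up (insert v R)" "C v \<notin> up Q"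
        using S(3) vn notle by (auto simp: up_def)
      ultimately have "card (up Q) < card (up (insert v R))"
        by (intro psubset_card_mono fin_up) blast
      then show ?thesis using Q(5) by simp
    qed
    ultimately show ?case using inc by blast
  qed
  then obtain Q where "card (up Q) \<ge> n" by auto
  moreover have "card (up Q) \<le> card S" using S(1) by (auto simp: up_def intro: card_mono)
  ultimately show False using S(2) by simp
qed

text \<open>Iterating the successor \<open>v \<union> {v}\<close> from the empty set (the von
  Neumann numerals) gives cliques of every size up to \<open>d\<close>.\<close>

lemma ex_clique_code_card:
  "m \<le> d \<Longrightarrow> \<exists>v\<in>clique_codes d (Suc m). card (set_decode v) = m"
proof (induction m)
  case 0
  show ?case
    by (rule bexI[of _ 0])
      (simp_all add: mem_clique_codes_Suc membership_clique_def)
next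
  case (Suc m)
  then obtain v where v: "v \<in> clique_codes d (Suc m)" "card (set_decode v) = m" by auto
  have vv: "v \<notin> set_decode v" using mem_set_decode_less by blast
  let ?w = "set_encode (insert v (set_decode v))"
  have w: "set_decode ?w = insert v (set_decode v)" by (rule set_encode_inverse) simp
  have "?w \<in> clique_codes d (Suc (Suc m))"
    unfolding mem_clique_codes_Suc[of _ _ "Suc m"] w
    using v Suc.prems mem_clique_codesD[OF v(1)] vv
    by (auto simp: membership_clique_def pairwise_insert)
  moreover have "card (set_decode ?w) = Suc m" unfolding w using v vv by simp
  ultimately show ?case by blast
qed

lemma cut_cover_char_set:
  assumes "cut_cover D k U" "(u, v) \<in> parcs D"
  shows "\<not> char_set k U u \<subseteq> char_set k U v"
  using assms by (force simp: cut_cover_def cut_def char_set_def)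

theorem theorem1p3:
  fixes d k :: nat
  assumes "d \<ge> 1" and "k \<ge> 1"
  shows "\<exists>D :: nat pair_pre_digraph.
    pair_digraph D \<and> acyclic (parcs D) \<and>
    (\<forall>v\<in>pverts D. in_degree D v \<le> d) \<and>
    (d \<le> 2 ^ k \<longrightarrow> (\<exists>v\<in>pverts D. in_degree D v = d)) \<and>
    (\<forall>v\<in>pverts D. transitive_tournament (D \<restriction> insert v (in_neighborhood D v))) \<and>
    (\<exists>l. digraph_hom l D (acyclic_tournament (2 ^ k + 1))) \<and>
    (\<forall>U. cut_cover D k U \<longrightarrow>
      (\<exists>v\<in>pverts D. in_degree D v = d \<and>
        pairwise (\<lambda>x y. \<not> char_set k U x \<subseteq> char_set k U y \<and> \<not> char_set k U y \<subseteq> char_set k U x)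
          (insert v (in_neighborhood D v)))) \<and>
    (d \<ge> k choose (k div 2) \<longrightarrow> \<not> covered_by_cuts D k)"
proof -
  let ?n = "2 ^ k + 1 :: nat"
  define D where "D = clique_code_graph d ?n"
  have V: "pverts D = clique_codes d ?n" by (simp add: D_def)
  have deg: "in_degree D v = card (set_decode v)" if "v \<in> pverts D" for v
    using that unfolding D_def by (simp add: in_degree_clique_code_graph)
  have nbh: "in_neighborhood D v = set_decode v" if "v \<in> pverts D" for v
    using that unfolding D_def by (simp add: in_neighborhood_clique_code_graph)
  have winner: "\<exists>v\<in>pverts D. card (set_decode v) = d \<and>
      incomparable_on (char_set k U) (insert v (set_decode v))" if U: "cut_cover D k U" for U
    unfolding V
  proof (rule clique_code_graph_incomparable)
    \<comment> \<open>There are \<open>2 ^ k\<close> possible characteristic sets, one fewer than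
      the number of levels; hence the size \<open>2 ^ k + 1\<close> of the tournament.\<close>
    show "finite (Pow {1..k})" "card (Pow {1..k}) < ?n" by (simp_all add: card_Pow)
    show "char_set k U ` clique_codes d ?n \<subseteq> Pow {1..k}" by (auto simp: char_set_def)
    show "\<not> char_set k U u \<le> char_set k U v"
      if "v \<in> clique_codes d ?n" "u \<in> set_decode v" for u v
      by (rule cut_cover_char_set[OF U]) (use that in \<open>simp add: D_def\<close>)
  qed
  have "\<exists>v\<in>pverts D. in_degree D v = d" if "d \<le> 2 ^ k"
    \<comment> \<open>The witness lies in level \<open>Suc d\<close>, which is within level
      \<open>2 ^ k + 1\<close> by the bound on \<open>d\<close>.\<close>
    using ex_clique_code_card[of d d] clique_codes_mono[of "Suc d" ?n d] that V deg by auto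
  moreover have "\<not> covered_by_cuts D k" if d: "d \<ge> k choose (k div 2)"
  proof
    assume "covered_by_cuts D k"
    then obtain U where "cut_cover D k U" by (auto simp: covered_by_cuts_def)
    then obtain v where v: "card (set_decode v) = d"
        "incomparable_on (char_set k U) (insert v (set_decode v))"
      using winner by blast
    let ?W = "insert v (set_decode v)"
    \<comment> \<open>Incomparability at distinct vertices includes inequality, so the
      \<open>d + 1\<close> vertices yield an antichain of \<open>d + 1\<close> subsets of
      \<open>{1..k}\<close>, exceeding Sperner's bound.\<close>
    have "inj_on (char_set k U) ?W"
      using v(2) by (force simp: incomparable_on_def pairwise_def inj_on_def)
    moreover have "v \<notin> set_decode v" using mem_set_decode_less by blast
    ultimately have "card (char_set k U ` ?W) = Suc d"
      using v(1) by (simp add: card_image del: image_insert)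
    moreover have "card (char_set k U ` ?W) \<le> card {1..k} choose (card {1..k} div 2)"
    proof (rule sperner)
      show "incomparable_on (\<lambda>S. S) (char_set k U ` ?W)"
        using v(2) unfolding incomparable_on_def by (auto intro: pairwise_imageI simp: pairwise_def)
    qed (auto simp: char_set_def)
    ultimately show False using d by simp
  qed
  moreover have "\<forall>U. cut_cover D k U \<longrightarrow>
      (\<exists>v\<in>pverts D. in_degree D v = d \<and>
        pairwise (\<lambda>x y. \<not> char_set k U x \<subseteq> char_set k U y \<and> \<not> char_set k U y \<subseteq> char_set k U x)
          (insert v (in_neighborhood D v)))"
  proof (intro allI impI)
    fix U assume "cut_cover D k U"
    from winner[OF this] obtain v where "v \<in> pverts D" "card (set_decode v) = d"
        "incomparable_on (char_set k U) (insert v (set_decode v))"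
      by blast
    then show "\<exists>v\<in>pverts D. in_degree D v = d \<and>
        pairwise (\<lambda>x y. \<not> char_set k U x \<subseteq> char_set k U y \<and> \<not> char_set k U y \<subseteq> char_set k U x)
          (insert v (in_neighborhood D v))"
      by (intro bexI[of _ v]) (simp_all add: deg nbh incomparable_on_def)
  qed
  moreover have "\<forall>v\<in>pverts D. in_degree D v \<le> d"
    using deg mem_clique_codesD(2) V by metis
  moreover have "pair_digraph D" "acyclic (parcs D)"
      "\<exists>l. digraph_hom l D (acyclic_tournament ?n)"
      "\<forall>v\<in>pverts D. transitive_tournament (D \<restriction> insert v (in_neighborhood D v))"
    unfolding D_def
    by (simp_all add: pair_digraph_clique_code_graph acyclic_clique_code_graph
        digraph_hom_clique_code_graph[of d ?n, simplified] transitive_tournament_clique_code_graph)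
  ultimately show ?thesis by blast
qed

end
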